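(* Let $\widetilde F^k$ be the HSGD estimator (see context), $\Delta_k:=\|\widetilde F^k-Fx^k\|^2$, $\delta_k^2:=\mathbb{E}_{\hat{\mathcal S}_k}[\|\bar Fx^k-Fx^k\|^2]$, and $\bar{\mathcal E}_k:=\mathbb{E}_\xi[\|\mathbf F(x^k,\xi)-\mathbf F(x^{k-1},\xi)\|^2]$. Then, for $k\ge1$, the following statements hold. (i) If $\mathcal S_k$ is independent of $\hat{\mathcal S}_k$, then $$\mathbb{E}_k[\Delta_k]\le(1-\tau_k)^2\Delta_{k-1}+\frac{(1-\tau_k)^2}{b_k}\bar{\mathcal E}_k+\tau_k^2\delta_k^2.$$ (ii) If $\mathcal S_k$ and $\hat{\mathcal S}_k$ are dependent or identical, then $$\mathbb{E}_k[\Delta_k]\le(1-\tau_k)^2\Delta_{k-1}+\frac{2(1-\tau_k)^2}{b_k}\bar{\mathcal E}_k+2\tau_k^2\delta_k^2.$$ (iii) If $\tau_k\in(0,1]$, the estimator $\widetilde F^k$ satisfies the $\mathbf{VR}(\Delta_k;\kappa_k,\Theta_k,\sigma_k)$ property (see context) with $\Delta_k=\|\widetilde F^k-Fx^k\|^2$, $\kappa_k:=1-(1-\tau_k)^2$, and: $\Theta_k=\frac{(1-\tau_k)^2}{b_k}$ and $\sigma_k^2=\frac{\tau_k^2\sigma^2}{\hat b_k}$ if $\mathcal S_k$ is independent of $\hat{\mathcal S}_k$; $\Theta_k=\frac{2(1-\tau_k)^2}{b_k}$ and $\sigma_k^2=\frac{2\tau_k^2\sigma^2}{\hat b_k}$ 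otherwise.
   Context: Setting: $F:\mathbb{R}^p\to\mathbb{R}^p$ with either $Fx=\frac1n\sum_{i=1}^nF_ix$ (finite-sum setting; then $\mathbf F(x,\xi)$ means $F_ix$ with $i$ uniform on $\{1,\dots,n\}$) or $Fx=\mathbb{E}_\xi[\mathbf F(x,\xi)]$ (expectation setting), with $\sigma\geq 0$ a variance bound: $\mathbb{E}_\xi[\|\mathbf F(x,\xi)-Fx\|^2]\le\sigma^2$ for all $x$. $\{x^k\}_{k\ge0}$ is a given sequence of iterates. $\mathcal F_k$ is the $\sigma$-algebra generated by all randomness up to the current iterates $x^0,\dots,x^k$, including all draws of iterations before $k$ (but not the draws made at iteration $k$, which are made independently of $\mathcal F_k$); $\mathbb{E}_k[\cdot]=\mathbb{E}[\cdot\mid\mathcal F_k]$. In $\mathbb{E}_\xi$, $\xi$ is a fresh copy independent of everything else. HSGD (hybrid SGD) estimator: $\widetilde F^0$ is an initial estimate with $\mathbb{E}_0[\|\widetilde F^0-Fx^0\|^2]\le\sigma^2/n_0$; for $k\ge1$, with an i.i.d. sample $\mathcal S_k$ of size $b_k$ and $\mathbf F(\cdot,\mathcal S_k):=\frac1{b_k}\sum_{\xi_i\in\mathcal S_k}\mathbf F(\cdot,\xi_i)$, $\widetilde F^k:=(1-\tau_k)\big[\widetilde F^{k-1}+\mathbf F(x^k,\mathcal S_k)-\mathbf F(x^{k-1},\mathcal S_k)\big]+\tau_k\bar Fx^k$, where $\tau_k\in[0,1]$ is a given weight and $\bar Fx^k$ is an unbiased estimator of $Fx^k$ constructed from an i.i.d.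 sample $\hat{\mathcal S}_k$ of size $\hat b_k$: $\mathbb{E}_{\hat{\mathcal S}_k}[\bar Fx^k]=Fx^k$ and $\mathbb{E}_{\hat{\mathcal S}_k}[\|\bar Fx^k-Fx^k\|^2]\le\sigma^2/\hat b_k$. $\mathcal S_k$ and $\hat{\mathcal S}_k$ are allowed to be dependent or identical. $\mathbf{VR}(\Delta_k;\kappa_k,\Theta_k,\sigma_k)$ property, for parameters $\kappa_k\in(0,1]$, $\Theta_k\ge0$, $\sigma_k\ge0$ and random $\Delta_k\ge0$: almost surely, $\mathbb{E}_k[\|\widetilde F^k-Fx^k\|^2]\le\mathbb{E}_k[\Delta_k]$ (for $k\ge0$) and $\mathbb{E}_k[\Delta_k]\le(1-\kappa_k)\Delta_{k-1}+\Theta_k\bar{\mathcal E}_k+\sigma_k^2$ (here for $k\ge1$). *)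

theory Defs
  imports "HOL-Probability.Probability"
begin

text \<open>
  \<open>\<Xi>\<close> is the law of one sample \<open>\<xi>\<close>; \<open>FF x \<xi>\<close> stands for the stochastic evaluation at \<open>x\<close>.
  The variance is a Lebesgue integral in \<^typ>\<open>ennreal\<close>, so the bound also says that it is finite.
  The finite-sum setting is the instance where \<open>\<Xi>\<close> is uniform on \<open>{1..n}\<close>; see
  \<open>finite_sum_oracle\<close> below.
\<close>

definition stochastic_oracle ::
  "'b measure \<Rightarrow> (real ^ 'p \<Rightarrow> 'b \<Rightarrow> real ^ 'p) \<Rightarrow> (real ^ 'p \<Rightarrow> real ^ 'p) \<Rightarrow> real \<Rightarrow> bool" where
  "stochastic_oracle \<Xi> FF F \<sigma> \<longleftrightarrow>
     prob_space \<Xi> \<and>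
     (\<lambda>(x, \<xi>). FF x \<xi>) \<in> borel_measurable (borel \<Otimes>\<^sub>M \<Xi>) \<and>
     (\<forall>x. has_bochner_integral \<Xi> (FF x) (F x)) \<and>
     0 \<le> \<sigma> \<and>
     (\<forall>x. (\<integral>\<^sup>+ \<xi>. ennreal ((norm (FF x \<xi> - F x))\<^sup>2) \<partial>\<Xi>) \<le> ennreal (\<sigma>\<^sup>2))"

lemma finite_sum_oracle:
  fixes Fi :: "nat \<Rightarrow> real ^ 'p \<Rightarrow> real ^ 'p"
  assumes n: "1 \<le> n" and \<sigma>: "0 \<le> \<sigma>"
    and meas: "\<And>i. i \<in> {1..n} \<Longrightarrow> Fi i \<in> borel_measurable borel"
    and mean: "\<And>x. F x = (1 / real n) *\<^sub>R (\<Sum>i=1..n. Fi i x)"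
    and var: "\<And>x. (1 / real n) * (\<Sum>i=1..n. (norm (Fi i x - F x))\<^sup>2) \<le> \<sigma>\<^sup>2"
  shows "stochastic_oracle (uniform_count_measure {1..n}) (\<lambda>x i. Fi i x) F \<sigma>"
proof -
  let ?U = "uniform_count_measure {1..n}"
  have ne: "{1..n} \<noteq> {}" using n by simp
  have "(\<lambda>p. Fi (fst p) (snd p)) \<in> borel_measurable (count_space {1..n} \<Otimes>\<^sub>M borel)"
    by (rule measurable_pair_measure_countable1) (auto intro: countable_finite meas)
  from measurable_pair_swap[OF this]
  have "(\<lambda>p. Fi (snd p) (fst p)) \<in> borel_measurable (borel \<Otimes>\<^sub>M count_space {1..n})"
    by (simp add: split_def)
  moreover have "sets (borel \<Otimes>\<^sub>M ?U) = sets (borel \<Otimes>\<^sub>M count_space {1..n} :: ((real ^ 'p) \<times> nat) measure)"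
    by (intro sets_pair_measure_cong) (simp_all add: sets_uniform_count_measure)
  ultimately have m: "(\<lambda>(x, i). Fi i x) \<in> borel_measurable (borel \<Otimes>\<^sub>M ?U)"
    by (simp add: split_def cong: measurable_cong_sets)
  have I: "has_bochner_integral ?U f ((1 / real n) *\<^sub>R (\<Sum>i=1..n. f i))"
    for f :: "nat \<Rightarrow> 'c :: {banach, second_countable_topology}"
    unfolding uniform_count_measure_def
    by (auto simp: has_bochner_integral_iff integrable_point_measure_finite
        lebesgue_integral_point_measure_finite scaleR_sum_right)
  have "(\<integral>\<^sup>+ i. ennreal ((norm (Fi i x - F x))\<^sup>2) \<partial>?U) \<le> ennreal (\<sigma>\<^sup>2)" for x
    using I[of "\<lambda>i. (norm (Fi i x - F x))\<^sup>2"] var[of x]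
    by (subst nn_integral_eq_integral) (auto simp: has_bochner_integral_iff intro: ennreal_leI)
  moreover have "has_bochner_integral ?U (\<lambda>i. Fi i x) (F x)" for x
    unfolding mean by (rule I)
  moreover have "prob_space ?U"
    using ne by (intro prob_space_uniform_count_measure) simp_all
  ultimately show ?thesis
    unfolding stochastic_oracle_def using m \<sigma> by blast
qed

abbreviation sample_space :: "'b measure \<Rightarrow> nat \<Rightarrow> (nat \<Rightarrow> 'b) measure" where
  "sample_space \<Xi> m \<equiv> Pi\<^sub>M {..<m} (\<lambda>_. \<Xi>)"

definition iid_sample :: "'w measure \<Rightarrow> 'b measure \<Rightarrow> nat \<Rightarrow> ('w \<Rightarrow> nat \<Rightarrow> 'b) \<Rightarrow> bool" where
  "iid_sample M \<Xi> m T \<longleftrightarrow>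
     T \<in> M \<rightarrow>\<^sub>M sample_space \<Xi> m \<and>
     prob_space.indep_vars M (\<lambda>_. \<Xi>) (\<lambda>i \<omega>. T \<omega> i) {..<m} \<and>
     (\<forall>i<m. distr M \<Xi> (\<lambda>\<omega>. T \<omega> i) = \<Xi>)"

definition minibatch :: "('a \<Rightarrow> 'b \<Rightarrow> real ^ 'p) \<Rightarrow> nat \<Rightarrow> 'a \<Rightarrow> (nat \<Rightarrow> 'b) \<Rightarrow> real ^ 'p" where
  "minibatch FF m y s = (1 / real m) *\<^sub>R (\<Sum>i<m. FF y (s i))"

text \<open>
  The \<open>\<sigma>\<close>-algebra of the information available when \<open>x 0, \<dots>, x k\<close> are known but the draws of
  iteration \<open>k\<close> are not. The only draw-dependent quantity of iteration \<open>0\<close> is the initial estimate \<open>F0\<close>.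
  The arbitrary random elements \<open>U j\<close> collect whatever further randomness is revealed up to \<open>x j\<close>
  (e.g. randomisation of the algorithm, or the sample behind \<open>F0\<close> as part of \<open>U 1\<close>).
\<close>

definition history ::
  "'w measure \<Rightarrow> 'b measure \<Rightarrow> 'u measure \<Rightarrow> (nat \<Rightarrow> 'w \<Rightarrow> 'u) \<Rightarrow> (nat \<Rightarrow> 'w \<Rightarrow> real ^ 'p) \<Rightarrow>
   ('w \<Rightarrow> real ^ 'p) \<Rightarrow> (nat \<Rightarrow> nat) \<Rightarrow> (nat \<Rightarrow> nat) \<Rightarrow>
   (nat \<Rightarrow> 'w \<Rightarrow> nat \<Rightarrow> 'b) \<Rightarrow> (nat \<Rightarrow> 'w \<Rightarrow> nat \<Rightarrow> 'b) \<Rightarrow> nat \<Rightarrow> 'w measure" where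
  "history M \<Xi> N U x F0 b bh S Sh k = sigma (space M)
     ((\<Union>j\<le>k. sets (vimage_algebra (space M) (x j) borel)) \<union>
      (\<Union>j\<le>k. sets (vimage_algebra (space M) (U j) N)) \<union>
      (if 1 \<le> k then sets (vimage_algebra (space M) F0 borel) else {}) \<union>
      (\<Union>j\<in>{1..<k}. sets (vimage_algebra (space M) (S j) (sample_space \<Xi> (b j)))) \<union>
      (\<Union>j\<in>{1..<k}. sets (vimage_algebra (space M) (Sh j) (sample_space \<Xi> (bh j)))))"

text \<open>
  \<open>Fbar k \<omega> s\<close> is the unbiased estimator at iteration \<open>k\<close> evaluated on the sample \<open>s\<close>; its dependence
  on \<open>\<omega>\<close> is through the history (basic case: \<open>Fbar k \<omega> s = G (x k \<omega>) s\<close>).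
\<close>

primrec hsgd ::
  "(real ^ 'p \<Rightarrow> 'b \<Rightarrow> real ^ 'p) \<Rightarrow> (nat \<Rightarrow> 'w \<Rightarrow> (nat \<Rightarrow> 'b) \<Rightarrow> real ^ 'p) \<Rightarrow>
   (nat \<Rightarrow> real) \<Rightarrow> (nat \<Rightarrow> nat) \<Rightarrow> (nat \<Rightarrow> 'w \<Rightarrow> real ^ 'p) \<Rightarrow> ('w \<Rightarrow> real ^ 'p) \<Rightarrow>
   (nat \<Rightarrow> 'w \<Rightarrow> nat \<Rightarrow> 'b) \<Rightarrow> (nat \<Rightarrow> 'w \<Rightarrow> nat \<Rightarrow> 'b) \<Rightarrow> nat \<Rightarrow> 'w \<Rightarrow> real ^ 'p" where
  "hsgd FF Fbar \<tau> b x F0 S Sh 0 \<omega> = F0 \<omega>"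
| "hsgd FF Fbar \<tau> b x F0 S Sh (Suc k) \<omega> =
     (1 - \<tau> (Suc k)) *\<^sub>R
       (hsgd FF Fbar \<tau> b x F0 S Sh k \<omega>
        + minibatch FF (b (Suc k)) (x (Suc k) \<omega>) (S (Suc k) \<omega>)
        - minibatch FF (b (Suc k)) (x k \<omega>) (S (Suc k) \<omega>))
     + \<tau> (Suc k) *\<^sub>R Fbar (Suc k) \<omega> (Sh (Suc k) \<omega>)"

definition Ebar ::
  "'b measure \<Rightarrow> (real ^ 'p \<Rightarrow> 'b \<Rightarrow> real ^ 'p) \<Rightarrow> (nat \<Rightarrow> 'w \<Rightarrow> real ^ 'p) \<Rightarrow> nat \<Rightarrow> 'w \<Rightarrow> ennreal" where
  "Ebar \<Xi> FF x k \<omega> = (\<integral>\<^sup>+ \<xi>. ennreal ((norm (FF (x k \<omega>) \<xi> - FF (x (k - 1) \<omega>) \<xi>))\<^sup>2) \<partial>\<Xi>)"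

text \<open>
  \<open>H k\<close> is the conditioning \<open>\<sigma>\<close>-algebra of iteration \<open>k\<close>. Conditional expectations of nonnegative
  variables are taken in \<^typ>\<open>ennreal\<close>, so no integrability is needed to make sense of them.
\<close>

definition VR_property ::
  "'w measure \<Rightarrow> (nat \<Rightarrow> 'w measure) \<Rightarrow> (real ^ 'p \<Rightarrow> real ^ 'p) \<Rightarrow> (nat \<Rightarrow> 'w \<Rightarrow> real ^ 'p) \<Rightarrow>
   (nat \<Rightarrow> 'w \<Rightarrow> ennreal) \<Rightarrow> (nat \<Rightarrow> 'w \<Rightarrow> real ^ 'p) \<Rightarrow>
   (nat \<Rightarrow> 'w \<Rightarrow> real) \<Rightarrow> (nat \<Rightarrow> real) \<Rightarrow> (nat \<Rightarrow> real) \<Rightarrow> (nat \<Rightarrow> real) \<Rightarrow> bool" where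
  "VR_property M H F x E Ft \<Delta> \<kappa> \<Theta> \<sigma> \<longleftrightarrow>
     (\<forall>k\<ge>1. 0 < \<kappa> k \<and> \<kappa> k \<le> 1 \<and> 0 \<le> \<Theta> k \<and> 0 \<le> \<sigma> k) \<and>
     (\<forall>k. \<Delta> k \<in> borel_measurable M \<and> (\<forall>\<omega>\<in>space M. 0 \<le> \<Delta> k \<omega>)) \<and>
     (\<forall>k. AE \<omega> in M.
        nn_cond_exp M (H k) (\<lambda>\<omega>. ennreal ((norm (Ft k \<omega> - F (x k \<omega>)))\<^sup>2)) \<omega>
          \<le> nn_cond_exp M (H k) (\<lambda>\<omega>. ennreal (\<Delta> k \<omega>)) \<omega>) \<and>
     (\<forall>k\<ge>1. AE \<omega> in M.
        nn_cond_exp M (H k) (\<lambda>\<omega>. ennreal (\<Delta> k \<omega>)) \<omega>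
          \<le> ennreal (1 - \<kappa> k) * ennreal (\<Delta> (k - 1) \<omega>) + ennreal (\<Theta> k) * E k \<omega> + ennreal ((\<sigma> k)\<^sup>2))"

end

theory Submission
  imports Defs
begin

text \<open>
  Write \<open>c = 1 - \<tau> k\<close>. Subtracting \<open>F (x k)\<close> from the recursion gives the identity
  \<open>Ft k - F (x k) = c a + c X + \<tau> k Y\<close>, where \<open>a\<close> is the estimation error of iteration \<open>k - 1\<close>, \<open>X\<close>
  is the error of the minibatch increment as an estimate of \<open>F (x k) - F (x (k - 1))\<close>, and \<open>Y\<close> is the
  error of the unbiased estimator. Conditionally on the history, \<open>a\<close> is a constant while \<open>X\<close> and \<open>Y\<close>
  are centred, so \<open>a\<close> is orthogonal to the noise and the conditional second moment is
  \<open>c\<^sup>2 |a|\<^sup>2 + E |c X + \<tau> k Y|\<^sup>2\<close>. If the two samples are independent, \<open>X\<close> and \<open>Y\<close> are orthogonal as well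
  and the last term splits exactly; in general \<open>|p + q|\<^sup>2 \<le> 2 |p|\<^sup>2 + 2 |q|\<^sup>2\<close> costs a factor 2. Finally
  \<open>X\<close> is a centred average of \<open>b k\<close> i.i.d. terms, so its second moment is at most \<open>Ebar / b k\<close>.

  Three lemmas carry the argument. \<open>nn_cond_exp_freeze\<close> turns the conditional expectation into an
  ordinary one: since the draws of iteration \<open>k\<close> are independent of the history, conditioning on the
  history means fixing everything that the history determines and averaging over the draws.
  \<open>second_moment_two_noises\<close> and \<open>sample_average_error\<close> are the two second-moment estimates for the
  frozen quantities. The bounds (i) and (ii) differ only in a factor \<open>r \<in> {1, 2}\<close>, so
  \<open>hybrid_step_cond_exp_le\<close> proves them together. Part (iii) inserts \<open>\<delta>2 k \<le> \<sigma>\<^sup>2 / bh k\<close>.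

  All second-moment identities need finite second moments. These come from the variance bound \<open>\<sigma>\<^sup>2\<close>:
  it makes every \<open>FF y\<close> square integrable, hence also the increments, and the variance bound on the
  unbiased estimator does the same for \<open>Y\<close>.
\<close>

section \<open>Square-integrable random vectors\<close>

definition square_integrable :: "'a measure \<Rightarrow> ('a \<Rightarrow> 'e::euclidean_space) \<Rightarrow> bool" where
  "square_integrable M f \<longleftrightarrow> f \<in> borel_measurable M \<and> integrable M (\<lambda>x. (norm (f x))\<^sup>2)"

lemma norm_add_sq_le:
  fixes a b :: "'e::real_inner"
  shows "(norm (a + b))\<^sup>2 \<le> 2 * (norm a)\<^sup>2 + 2 * (norm b)\<^sup>2"
proof -
  have "0 \<le> (a - b) \<bullet> (a - b)" by simp
  then show ?thesis
    by (simp add: power2_norm_eq_inner inner_add_left inner_add_right inner_diff_left inner_diff_right inner_commute[of b a])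
qed

lemma square_integrable_add:
  assumes "square_integrable M f" "square_integrable M g"
  shows "square_integrable M (\<lambda>x. f x + g x)"
proof -
  have [measurable]: "f \<in> borel_measurable M" "g \<in> borel_measurable M"
    using assms by (simp_all add: square_integrable_def)
  have "integrable M (\<lambda>x. 2 * (norm (f x))\<^sup>2 + 2 * (norm (g x))\<^sup>2)"
    using assms by (simp add: square_integrable_def)
  then have "integrable M (\<lambda>x. (norm (f x + g x))\<^sup>2)"
    by (rule Bochner_Integration.integrable_bound) (auto intro: order_trans[OF norm_add_sq_le])
  then show ?thesis by (simp add: square_integrable_def)
qed

lemma square_integrable_scaleR:
  "square_integrable M f \<Longrightarrow> square_integrable M (\<lambda>x. c *\<^sub>R f x)"
  by (auto simp: square_integrable_def power_mult_distrib)

lemma (in finite_measure) square_integrable_const: "square_integrable M (\<lambda>_. c)"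
  by (simp add: square_integrable_def)

lemma square_integrable_diff_const:
  assumes "finite_measure M" "square_integrable M f"
  shows "square_integrable M (\<lambda>x. f x - c)"
  using square_integrable_add[OF assms(2) finite_measure.square_integrable_const[OF assms(1), of "- c"]]
  by simp

lemma square_integrable_sum:
  assumes "finite I" "\<And>i. i \<in> I \<Longrightarrow> square_integrable M (f i)"
  shows "square_integrable M (\<lambda>x. \<Sum>i\<in>I. f i x)"
  using assms
proof (induction I)
  case empty
  then show ?case by (simp add: square_integrable_def)
next
  case (insert i I)
  then show ?case by (simp add: square_integrable_add)
qed

text \<open>
  By polarisation the inner product is a combination of three squared norms.
\<close>

lemma square_integrable_inner:
  assumes "square_integrable M f" "square_integrable M g"
  shows "integrable M (\<lambda>x. f x \<bullet> g x)"
proof -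
  have "integrable M (\<lambda>x. ((norm (f x + g x))\<^sup>2 - (norm (f x))\<^sup>2 - (norm (g x))\<^sup>2) / 2)"
    using assms square_integrable_add[OF assms]
    by (intro integrable_divide Bochner_Integration.integrable_diff) (simp_all add: square_integrable_def)
  then show ?thesis by (simp add: dot_norm)
qed

lemma (in finite_measure) square_integrable_imp_integrable_vec:
  assumes f: "square_integrable M f"
  shows "integrable M f"
proof -
  have m: "f \<in> borel_measurable M" and i: "integrable M (\<lambda>x. (norm (f x))\<^sup>2)"
    using f by (simp_all only: square_integrable_def)
  have "integrable M (\<lambda>x. norm (f x))"
    by (rule square_integrable_imp_integrable[OF _ i]) (use m in measurable)
  then show ?thesis
    by (simp only: integrable_norm_iff[OF m])
qed

lemma square_integrableI_nn_integral:
  assumes f: "f \<in> borel_measurable M" and fin: "(\<integral>\<^sup>+ x. ennreal ((norm (f x))\<^sup>2) \<partial>M) < \<infinity>"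
  shows "square_integrable M f"
proof -
  have "integrable M (\<lambda>x. (norm (f x))\<^sup>2)"
    by (rule integrableI_nonneg) (use f fin in simp_all)
  with f show ?thesis by (simp only: square_integrable_def)
qed

lemma nn_integral_norm_sq:
  assumes "square_integrable M f"
  shows "(\<integral>\<^sup>+ x. ennreal ((norm (f x))\<^sup>2) \<partial>M) = ennreal (\<integral>x. (norm (f x))\<^sup>2 \<partial>M)"
  using assms by (intro nn_integral_eq_integral) (simp_all add: square_integrable_def)

text \<open>
  The next two lemmas transfer moments from a law to a random element \<open>X\<close> that has this law; an
  i.i.d. draw is used through the equation \<open>distr M L X = L\<close> only.
\<close>

lemma square_integrable_distr:
  assumes "X \<in> M \<rightarrow>\<^sub>M L" "distr M L X = L" "square_integrable L f"
  shows "square_integrable M (\<lambda>\<omega>. f (X \<omega>))"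
proof -
  have f: "f \<in> borel_measurable L" and i: "integrable L (\<lambda>x. (norm (f x))\<^sup>2)"
    using assms(3) by (simp_all add: square_integrable_def)
  have "integrable M (\<lambda>\<omega>. (norm (f (X \<omega>)))\<^sup>2)"
    by (rule integrable_distr[OF assms(1)]) (use i assms(2) in simp)
  then show ?thesis
    using measurable_compose[OF assms(1) f] by (simp add: square_integrable_def)
qed

lemma integral_distr_eq:
  fixes f :: "'b \<Rightarrow> 'e::euclidean_space"
  assumes "X \<in> M \<rightarrow>\<^sub>M L" "distr M L X = L" "f \<in> borel_measurable L"
  shows "(\<integral>\<omega>. f (X \<omega>) \<partial>M) = (\<integral>z. f z \<partial>L)"
  using integral_distr[OF assms(1) assms(3)] assms(2) by simp

section \<open>Second moments of sums with centred noise\<close>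

lemma integral_norm_add_sq:
  assumes "square_integrable M f" "square_integrable M g"
  shows "(\<integral>x. (norm (f x + g x))\<^sup>2 \<partial>M) =
    (\<integral>x. (norm (f x))\<^sup>2 \<partial>M) + 2 * (\<integral>x. f x \<bullet> g x \<partial>M) + (\<integral>x. (norm (g x))\<^sup>2 \<partial>M)"
proof -
  have "(norm (f x + g x))\<^sup>2 = (norm (f x))\<^sup>2 + 2 * (f x \<bullet> g x) + (norm (g x))\<^sup>2" for x
    by (simp add: power2_norm_eq_inner inner_add_left inner_add_right inner_commute[of "g x" "f x"])
  moreover have "integrable M (\<lambda>x. (norm (f x))\<^sup>2)" "integrable M (\<lambda>x. (norm (g x))\<^sup>2)"
    using assms by (simp_all add: square_integrable_def)
  moreover note square_integrable_inner[OF assms]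
  ultimately show ?thesis
    by (simp only: Bochner_Integration.integral_add Bochner_Integration.integrable_add
        integrable_mult_right integral_mult_right_zero)
qed

text \<open>
  A centred vector is orthogonal to every constant.
\<close>

lemma (in prob_space) expectation_norm_const_add_sq:
  assumes W: "square_integrable M W" and "expectation W = 0"
  shows "expectation (\<lambda>x. (norm (a + W x))\<^sup>2) = (norm a)\<^sup>2 + expectation (\<lambda>x. (norm (W x))\<^sup>2)"
  using integral_norm_add_sq[OF square_integrable_const W, of a] assms(2)
    square_integrable_imp_integrable_vec[OF W]
  by (simp add: prob_space)

text \<open>
  Bias-variance decomposition: the second moment exceeds the variance by the squared norm of the mean.
\<close>

lemma (in prob_space) expectation_norm_diff_expectation_sq_le:
  assumes W: "square_integrable M W"
  shows "expectation (\<lambda>x. (norm (W x - expectation W))\<^sup>2) \<le> expectation (\<lambda>x. (norm (W x))\<^sup>2)"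
proof -
  have "integrable M W" by (rule square_integrable_imp_integrable_vec[OF W])
  then have "expectation (\<lambda>x. W x - expectation W) = 0"
    by (simp add: prob_space)
  from expectation_norm_const_add_sq[OF square_integrable_diff_const[OF finite_measure_axioms W] this,
    of "expectation W"]
  show ?thesis by simp
qed

text \<open>
  Coordinatewise, this is the product rule for real independent variables.
\<close>

lemma (in prob_space) indep_var_expectation_inner:
  fixes X Y :: "'a \<Rightarrow> 'e::euclidean_space"
  assumes ind: "indep_var borel X borel Y" and X: "integrable M X" and Y: "integrable M Y"
  shows "expectation (\<lambda>\<omega>. X \<omega> \<bullet> Y \<omega>) = expectation X \<bullet> expectation Y"
proof -
  have ind': "indep_var borel (\<lambda>\<omega>. X \<omega> \<bullet> e) borel (\<lambda>\<omega>. Y \<omega> \<bullet> e)" for e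
    using indep_var_compose[OF ind, of "\<lambda>v. v \<bullet> e" borel "\<lambda>v. v \<bullet> e" borel] by (simp add: comp_def)
  have X': "integrable M (\<lambda>\<omega>. X \<omega> \<bullet> e)" and Y': "integrable M (\<lambda>\<omega>. Y \<omega> \<bullet> e)" for e
    using X Y by auto
  note prod = indep_var_integrable[OF ind' X' Y'] indep_var_lebesgue_integral[OF ind' X' Y']
  have "expectation (\<lambda>\<omega>. X \<omega> \<bullet> Y \<omega>) = expectation (\<lambda>\<omega>. \<Sum>e\<in>Basis. (X \<omega> \<bullet> e) * (Y \<omega> \<bullet> e))"
    by (simp add: euclidean_inner[symmetric])
  also have "\<dots> = (\<Sum>e\<in>Basis. (expectation X \<bullet> e) * (expectation Y \<bullet> e))"
    using X Y by (simp add: prod)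
  finally show ?thesis by (simp add: euclidean_inner[symmetric])
qed

text \<open>
  Bienayme's identity for vectors: each term is independent of the sum of the earlier ones, so
  all cross terms vanish.
\<close>

lemma (in prob_space) expectation_norm_sum_indep_sq:
  fixes Z :: "'i \<Rightarrow> 'a \<Rightarrow> 'e::euclidean_space"
  assumes I: "finite I" and ind: "indep_vars (\<lambda>_. borel) Z I"
    and sq: "\<And>i. i \<in> I \<Longrightarrow> square_integrable M (Z i)"
    and mean: "\<And>i. i \<in> I \<Longrightarrow> expectation (Z i) = 0"
  shows "expectation (\<lambda>\<omega>. (norm (\<Sum>i\<in>I. Z i \<omega>))\<^sup>2) = (\<Sum>i\<in>I. expectation (\<lambda>\<omega>. (norm (Z i \<omega>))\<^sup>2))"
  using I sq mean ind
proof (induction I)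
  case empty
  then show ?case by simp
next
  case (insert i I)
  have rest: "square_integrable M (\<lambda>\<omega>. \<Sum>j\<in>I. Z j \<omega>)"
    using insert by (intro square_integrable_sum) auto
  have "indep_var
      borel ((\<lambda>f. f i) \<circ> (\<lambda>\<omega>. restrict (\<lambda>j. Z j \<omega>) {i}))
      borel ((\<lambda>f. \<Sum>j\<in>I. f j) \<circ> (\<lambda>\<omega>. restrict (\<lambda>j. Z j \<omega>) I))"
    using insert.hyps by (intro indep_var_compose[OF indep_var_restrict[OF insert.prems(3)]]) auto
  also have "(\<lambda>f. f i) \<circ> (\<lambda>\<omega>. restrict (\<lambda>j. Z j \<omega>) {i}) = Z i"
    by auto
  also have "(\<lambda>f. \<Sum>j\<in>I. f j) \<circ> (\<lambda>\<omega>. restrict (\<lambda>j. Z j \<omega>) I) = (\<lambda>\<omega>. \<Sum>j\<in>I. Z j \<omega>)"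
    by auto
  finally have "expectation (\<lambda>\<omega>. Z i \<omega> \<bullet> (\<Sum>j\<in>I. Z j \<omega>)) =
      expectation (Z i) \<bullet> expectation (\<lambda>\<omega>. \<Sum>j\<in>I. Z j \<omega>)"
    using insert.prems(1)[of i] rest
    by (intro indep_var_expectation_inner square_integrable_imp_integrable_vec) auto
  also have "\<dots> = 0"
    using insert.prems(2)[of i] by simp
  finally have orth: "expectation (\<lambda>\<omega>. Z i \<omega> \<bullet> (\<Sum>j\<in>I. Z j \<omega>)) = 0" .
  have "expectation (\<lambda>\<omega>. (norm (\<Sum>j\<in>I. Z j \<omega>))\<^sup>2) = (\<Sum>j\<in>I. expectation (\<lambda>\<omega>. (norm (Z j \<omega>))\<^sup>2))"
    using insert.prems indep_vars_subset[OF insert.prems(3), of I] by (intro insert.IH) auto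
  then show ?case
    using insert.hyps integral_norm_add_sq[OF insert.prems(1)[of i] rest] orth by simp
qed

text \<open>
  The parameter \<open>r\<close> covers both regimes: \<open>r = 1\<close> when independence makes the two noises orthogonal,
  and \<open>r = 2\<close> when nothing is known about their joint law.
\<close>

lemma (in prob_space) second_moment_two_noises:
  fixes X Y :: "'a \<Rightarrow> 'e::euclidean_space"
  assumes X: "square_integrable M X" "expectation X = 0"
    and Y: "square_integrable M Y" "expectation Y = 0"
    and r: "r = 2 \<or> r = 1 \<and> indep_var borel X borel Y"
  shows "expectation (\<lambda>\<omega>. (norm (a + (c *\<^sub>R X \<omega> + e *\<^sub>R Y \<omega>)))\<^sup>2) \<le>
    (norm a)\<^sup>2 + r * c\<^sup>2 * expectation (\<lambda>\<omega>. (norm (X \<omega>))\<^sup>2) + r * e\<^sup>2 * expectation (\<lambda>\<omega>. (norm (Y \<omega>))\<^sup>2)"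
proof -
  let ?W = "\<lambda>\<omega>. c *\<^sub>R X \<omega> + e *\<^sub>R Y \<omega>"
  have cX: "square_integrable M (\<lambda>\<omega>. c *\<^sub>R X \<omega>)" and eY: "square_integrable M (\<lambda>\<omega>. e *\<^sub>R Y \<omega>)"
    by (intro square_integrable_scaleR X Y)+
  have W: "square_integrable M ?W"
    by (rule square_integrable_add[OF cX eY])
  have iX: "integrable M X" and iY: "integrable M Y"
    by (intro square_integrable_imp_integrable_vec X Y)+
  have sX: "expectation (\<lambda>\<omega>. (norm (c *\<^sub>R X \<omega>))\<^sup>2) = c\<^sup>2 * expectation (\<lambda>\<omega>. (norm (X \<omega>))\<^sup>2)"
    and sY: "expectation (\<lambda>\<omega>. (norm (e *\<^sub>R Y \<omega>))\<^sup>2) = e\<^sup>2 * expectation (\<lambda>\<omega>. (norm (Y \<omega>))\<^sup>2)"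
    by (simp_all add: power_mult_distrib)
  have "expectation ?W = 0"
    using iX iY X(2) Y(2) by simp
  then have total: "expectation (\<lambda>\<omega>. (norm (a + ?W \<omega>))\<^sup>2) = (norm a)\<^sup>2 + expectation (\<lambda>\<omega>. (norm (?W \<omega>))\<^sup>2)"
    by (rule expectation_norm_const_add_sq[OF W])
  have noise: "expectation (\<lambda>\<omega>. (norm (?W \<omega>))\<^sup>2) \<le>
      r * (c\<^sup>2 * expectation (\<lambda>\<omega>. (norm (X \<omega>))\<^sup>2)) + r * (e\<^sup>2 * expectation (\<lambda>\<omega>. (norm (Y \<omega>))\<^sup>2))"
    using r
  proof
    assume r: "r = 2"
    have "expectation (\<lambda>\<omega>. (norm (?W \<omega>))\<^sup>2) \<le>
        expectation (\<lambda>\<omega>. 2 * (norm (c *\<^sub>R X \<omega>))\<^sup>2 + 2 * (norm (e *\<^sub>R Y \<omega>))\<^sup>2)"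
      using W cX eY by (intro integral_mono norm_add_sq_le) (simp_all only: square_integrable_def
          Bochner_Integration.integrable_add integrable_mult_right)
    also have "\<dots> = 2 * expectation (\<lambda>\<omega>. (norm (c *\<^sub>R X \<omega>))\<^sup>2) + 2 * expectation (\<lambda>\<omega>. (norm (e *\<^sub>R Y \<omega>))\<^sup>2)"
      using cX eY by (simp only: square_integrable_def
          Bochner_Integration.integral_add integrable_mult_right integral_mult_right_zero)
    finally show ?thesis by (simp only: sX sY r)
  next
    assume r: "r = 1 \<and> indep_var borel X borel Y"
    then have "expectation (\<lambda>\<omega>. X \<omega> \<bullet> Y \<omega>) = 0"
      using indep_var_expectation_inner[OF _ iX iY] X(2) by simp
    then show ?thesis
      using integral_norm_add_sq[OF cX eY] r unfolding sX sY by simp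
  qed
  show ?thesis
    unfolding total using noise by (simp add: algebra_simps)
qed

section \<open>Freezing the history\<close>

text \<open>
  If \<open>Z\<close> is independent of \<open>G\<close>, then the joint law of the identity into \<open>G\<close> and \<open>Z\<close> is the product of the
  marginals, so for \<open>A \<in> sets G\<close> Fubini's theorem evaluates the integral of \<open>h \<omega> (Z \<omega>)\<close> over \<open>A\<close> by
  averaging over \<open>Z\<close> with \<open>\<omega>\<close> held fixed. This is the defining property of the conditional expectation.
\<close>

lemma (in prob_space) nn_cond_exp_freeze:
  assumes sub: "subalgebra M G" and Z: "Z \<in> M \<rightarrow>\<^sub>M P"
    and ind: "indep_set (sets G) (sets (vimage_algebra (space M) Z P))"
    and h: "(\<lambda>(\<omega>, z). h \<omega> z) \<in> borel_measurable (G \<Otimes>\<^sub>M P)"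
  shows "AE \<omega> in M. nn_cond_exp M G (\<lambda>\<omega>. h \<omega> (Z \<omega>)) \<omega> = (\<integral>\<^sup>+ \<omega>'. h \<omega> (Z \<omega>') \<partial>M)"
proof -
  interpret finite_measure_subalgebra M G by unfold_locales (rule sub)
  have spG: "space G = space M" using sub by (simp add: subalgebra_def)
  have id: "(\<lambda>\<omega>. \<omega>) \<in> M \<rightarrow>\<^sub>M G"
    using measurable_from_subalg[OF sub measurable_ident] by (simp add: id_def)
  interpret DG: prob_space "distr M G (\<lambda>\<omega>. \<omega>)" by (rule prob_space_distr) (rule id)
  interpret DZ: prob_space "distr M P Z" by (rule prob_space_distr) (rule Z)
  note [measurable] = h id Z
  have idZ: "(\<lambda>\<omega>. (\<omega>, Z \<omega>)) \<in> M \<rightarrow>\<^sub>M G \<Otimes>\<^sub>M P" by (rule measurable_Pair[OF id Z])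
  have joint: "distr M G (\<lambda>\<omega>. \<omega>) \<Otimes>\<^sub>M distr M P Z = distr M (G \<Otimes>\<^sub>M P) (\<lambda>\<omega>. (\<omega>, Z \<omega>))"
  proof (rule pair_measure_eqI)
    show "sigma_finite_measure (distr M G (\<lambda>\<omega>. \<omega>))" "sigma_finite_measure (distr M P Z)"
      by (rule DG.sigma_finite_measure, rule DZ.sigma_finite_measure)
    fix A B assume "A \<in> sets (distr M G (\<lambda>\<omega>. \<omega>))" "B \<in> sets (distr M P Z)"
    then have A: "A \<in> sets G" and B: "B \<in> sets P" by simp_all
    have AM: "A \<subseteq> space M" using sets.sets_into_space[OF A] spG by simp
    have "emeasure M (A \<inter> (Z -` B \<inter> space M)) = emeasure M A * emeasure M (Z -` B \<inter> space M)"
      using indep_setD[OF ind A in_vimage_algebra[OF B]]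
      by (simp add: emeasure_eq_measure ennreal_mult)
    moreover have "(\<lambda>\<omega>. (\<omega>, Z \<omega>)) -` (A \<times> B) \<inter> space M = A \<inter> (Z -` B \<inter> space M)"
      using AM by auto
    moreover have "(\<lambda>\<omega>. \<omega>) -` A \<inter> space M = A"
      using AM by auto
    ultimately show "emeasure (distr M G (\<lambda>\<omega>. \<omega>)) A * emeasure (distr M P Z) B =
        emeasure (distr M (G \<Otimes>\<^sub>M P) (\<lambda>\<omega>. (\<omega>, Z \<omega>))) (A \<times> B)"
      using A B by (simp add: emeasure_distr[OF id] emeasure_distr[OF Z] emeasure_distr[OF idZ])
  qed simp
  \<comment> \<open>the candidate: integrate \<open>Z\<close> out against its own law\<close>
  let ?g = "\<lambda>\<omega>. \<integral>\<^sup>+ z. h \<omega> z \<partial>distr M P Z"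
  have g[measurable]: "?g \<in> borel_measurable G"
    by (rule DZ.borel_measurable_nn_integral) simp
  have gG: "?g \<omega> = (\<integral>\<^sup>+ \<omega>'. h \<omega> (Z \<omega>') \<partial>M)" if "\<omega> \<in> space M" for \<omega>
    using that spG by (intro nn_integral_distr) auto
  have hZ: "(\<lambda>\<omega>. h \<omega> (Z \<omega>)) \<in> borel_measurable M"
    using measurable_compose[OF idZ h] by simp
  have "AE \<omega> in M. ?g \<omega> = nn_cond_exp M G (\<lambda>\<omega>. h \<omega> (Z \<omega>)) \<omega>"
  proof (rule nn_cond_exp_charact)
    fix A assume [measurable]: "A \<in> sets G"
    have "(\<integral>\<^sup>+ \<omega>\<in>A. h \<omega> (Z \<omega>) \<partial>M) =
        (\<integral>\<^sup>+ p. (case p of (\<omega>, z) \<Rightarrow> h \<omega> z * indicator A \<omega>) \<partial>distr M (G \<Otimes>\<^sub>M P) (\<lambda>\<omega>. (\<omega>, Z \<omega>)))"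
      by (subst nn_integral_distr) (simp_all add: split_beta')
    also have "\<dots> = (\<integral>\<^sup>+ \<omega>. \<integral>\<^sup>+ z. h \<omega> z * indicator A \<omega> \<partial>distr M P Z \<partial>distr M G (\<lambda>\<omega>. \<omega>))"
      unfolding joint[symmetric] by (subst DZ.nn_integral_fst[symmetric]) auto
    also have "\<dots> = (\<integral>\<^sup>+ \<omega>. \<integral>\<^sup>+ z. h \<omega> z * indicator A \<omega> \<partial>distr M P Z \<partial>M)"
      by (rule nn_integral_distr) measurable
    also have "\<dots> = (\<integral>\<^sup>+ \<omega>\<in>A. ?g \<omega> \<partial>M)"
      using spG by (intro nn_integral_cong nn_integral_multc) auto
    finally show "(\<integral>\<^sup>+ \<omega>\<in>A. h \<omega> (Z \<omega>) \<partial>M) = (\<integral>\<^sup>+ \<omega>\<in>A. ?g \<omega> \<partial>M)" .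
  qed (use hZ g in auto)
  then show ?thesis
    using AE_space by eventually_elim (simp add: gG)
qed

section \<open>Averages over i.i.d. samples\<close>

lemma iid_sample_measurable: "iid_sample M \<Xi> m T \<Longrightarrow> T \<in> M \<rightarrow>\<^sub>M sample_space \<Xi> m"
  by (simp add: iid_sample_def)

lemma (in prob_space) iid_sample_distr:
  assumes T: "iid_sample M \<Xi> m T" and m: "1 \<le> m"
  shows "distr M (sample_space \<Xi> m) T = sample_space \<Xi> m"
proof -
  have Tm: "T \<in> M \<rightarrow>\<^sub>M sample_space \<Xi> m" by (rule iid_sample_measurable[OF T])
  have ind: "indep_vars (\<lambda>_. \<Xi>) (\<lambda>i \<omega>. T \<omega> i) {..<m}"
    and law: "\<And>i. i < m \<Longrightarrow> distr M \<Xi> (\<lambda>\<omega>. T \<omega> i) = \<Xi>"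
    using T by (simp_all add: iid_sample_def)
  have ne: "{..<m} \<noteq> {}" using m by (simp add: lessThan_empty_iff)
  \<comment> \<open>points of \<open>sample_space\<close> are extensional, so restricting to the index set changes nothing\<close>
  have "(\<lambda>i\<in>{..<m}. T \<omega> i) = T \<omega>" if "\<omega> \<in> space M" for \<omega>
    using measurable_space[OF Tm that] by (auto simp: space_PiM intro: PiE_restrict)
  then have "distr M (sample_space \<Xi> m) T = distr M (sample_space \<Xi> m) (\<lambda>\<omega>. \<lambda>i\<in>{..<m}. T \<omega> i)"
    by (intro distr_cong) simp_all
  also have "\<dots> = Pi\<^sub>M {..<m} (\<lambda>i. distr M \<Xi> (\<lambda>\<omega>. T \<omega> i))"
    using ind ne by (subst indep_vars_iff_distr_eq_PiM'[symmetric])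
      (simp_all add: indep_vars_def)
  also have "\<dots> = sample_space \<Xi> m"
    by (intro PiM_cong) (simp_all add: law)
  finally show ?thesis .
qed

text \<open>
  The error is a sum of \<open>m\<close> independent centred terms scaled by \<open>1 / m\<close>, so its second moment is the
  variance of one term divided by \<open>m\<close>; the variance of \<open>D\<close> is at most its second moment.
\<close>

lemma (in prob_space) sample_average_error:
  fixes D :: "'b \<Rightarrow> 'e::euclidean_space"
  assumes \<Xi>: "prob_space \<Xi>" and T: "iid_sample M \<Xi> m T" and m: "1 \<le> m"
    and D: "square_integrable \<Xi> D" and d: "d = (\<integral>\<xi>. D \<xi> \<partial>\<Xi>)"
  defines "err \<equiv> \<lambda>\<omega>. (1 / real m) *\<^sub>R (\<Sum>i<m. D (T \<omega> i)) - d"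
  shows "square_integrable M err" "expectation err = 0"
    "expectation (\<lambda>\<omega>. (norm (err \<omega>))\<^sup>2) \<le> (\<integral>\<xi>. (norm (D \<xi>))\<^sup>2 \<partial>\<Xi>) / real m"
proof -
  interpret \<Xi>: prob_space \<Xi> by (rule \<Xi>)
  define Z where "Z = (\<lambda>i \<omega>. D (T \<omega> i) - d)"
  have Dm: "D \<in> borel_measurable \<Xi>" using D by (simp add: square_integrable_def)
  have D': "square_integrable \<Xi> (\<lambda>\<xi>. D \<xi> - d)"
    by (rule square_integrable_diff_const[OF \<Xi>.finite_measure_axioms D])
  have Dm': "(\<lambda>\<xi>. D \<xi> - d) \<in> borel_measurable \<Xi>" using Dm by simp
  have ind: "indep_vars (\<lambda>_. \<Xi>) (\<lambda>i \<omega>. T \<omega> i) {..<m}"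
    and law: "\<And>i. i < m \<Longrightarrow> distr M \<Xi> (\<lambda>\<omega>. T \<omega> i) = \<Xi>"
    using T by (simp_all add: iid_sample_def)
  have Ti: "(\<lambda>\<omega>. T \<omega> i) \<in> M \<rightarrow>\<^sub>M \<Xi>" if "i < m" for i
    using ind that by (simp add: indep_vars_def)
  have Z: "square_integrable M (Z i)" if "i < m" for i
    unfolding Z_def by (rule square_integrable_distr[OF Ti[OF that] law[OF that] D'])
  have "(\<integral>\<xi>. D \<xi> - d \<partial>\<Xi>) = 0"
    using \<Xi>.square_integrable_imp_integrable_vec[OF D] by (simp add: d \<Xi>.prob_space)
  then have Z0: "expectation (Z i) = 0" if "i < m" for i
    unfolding Z_def using integral_distr_eq[OF Ti[OF that] law[OF that] Dm'] by simp
  have Zv: "expectation (\<lambda>\<omega>. (norm (Z i \<omega>))\<^sup>2) \<le> (\<integral>\<xi>. (norm (D \<xi>))\<^sup>2 \<partial>\<Xi>)" if "i < m" for i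
  proof -
    have "expectation (\<lambda>\<omega>. (norm (Z i \<omega>))\<^sup>2) = (\<integral>\<xi>. (norm (D \<xi> - d))\<^sup>2 \<partial>\<Xi>)"
      unfolding Z_def by (rule integral_distr_eq[OF Ti[OF that] law[OF that]]) (use Dm in measurable)
    also have "\<dots> \<le> (\<integral>\<xi>. (norm (D \<xi>))\<^sup>2 \<partial>\<Xi>)"
      unfolding d by (rule \<Xi>.expectation_norm_diff_expectation_sq_le[OF D])
    finally show ?thesis .
  qed
  have indZ: "indep_vars (\<lambda>_. borel) Z {..<m}"
    unfolding Z_def by (rule indep_vars_compose2[OF ind Dm'])
  have err: "err = (\<lambda>\<omega>. (1 / real m) *\<^sub>R (\<Sum>i<m. Z i \<omega>))"
    using m by (simp add: err_def Z_def sum_subtractf scaleR_diff_right scaleR_sum_right[symmetric] sum_constant_scaleR)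
  have sumZ: "square_integrable M (\<lambda>\<omega>. \<Sum>i<m. Z i \<omega>)"
    by (intro square_integrable_sum) (simp_all add: Z)
  show "square_integrable M err"
    unfolding err by (rule square_integrable_scaleR[OF sumZ])
  show "expectation err = 0"
  proof -
    have "expectation (\<lambda>\<omega>. \<Sum>i<m. Z i \<omega>) = (\<Sum>i<m. expectation (Z i))"
      using Z by (intro Bochner_Integration.integral_sum square_integrable_imp_integrable_vec) simp
    then show ?thesis
      by (simp add: err Z0)
  qed
  have "expectation (\<lambda>\<omega>. (norm (err \<omega>))\<^sup>2) =
      (1 / real m)\<^sup>2 * expectation (\<lambda>\<omega>. (norm (\<Sum>i<m. Z i \<omega>))\<^sup>2)"
    by (simp add: err power_mult_distrib power_divide)
  also have "\<dots> = (1 / real m)\<^sup>2 * (\<Sum>i<m. expectation (\<lambda>\<omega>. (norm (Z i \<omega>))\<^sup>2))"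
    by (subst expectation_norm_sum_indep_sq[OF _ indZ]) (simp_all add: Z Z0)
  also have "\<dots> \<le> (1 / real m)\<^sup>2 * (\<Sum>i<m. (\<integral>\<xi>. (norm (D \<xi>))\<^sup>2 \<partial>\<Xi>))"
    by (intro mult_left_mono sum_mono) (simp_all add: Zv)
  also have "\<dots> = (\<integral>\<xi>. (norm (D \<xi>))\<^sup>2 \<partial>\<Xi>) / real m"
    by (simp add: power2_eq_square)
  finally show "expectation (\<lambda>\<omega>. (norm (err \<omega>))\<^sup>2) \<le> (\<integral>\<xi>. (norm (D \<xi>))\<^sup>2 \<partial>\<Xi>) / real m" .
qed

lemma measurable_minibatch:
  assumes FF: "(\<lambda>(x, \<xi>). FF x \<xi>) \<in> borel_measurable (borel \<Otimes>\<^sub>M \<Xi>)" and y: "y \<in> borel_measurable G"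
  shows "(\<lambda>(\<omega>, s). minibatch FF m (y \<omega>) s) \<in> borel_measurable (G \<Otimes>\<^sub>M sample_space \<Xi> m)"
proof -
  have "(\<lambda>p. FF (y (fst p)) (snd p i)) \<in> borel_measurable (G \<Otimes>\<^sub>M sample_space \<Xi> m)" if "i < m" for i
  proof -
    have "(\<lambda>p. (y (fst p), snd p i)) \<in> G \<Otimes>\<^sub>M sample_space \<Xi> m \<rightarrow>\<^sub>M borel \<Otimes>\<^sub>M \<Xi>"
      using that
      by (intro measurable_Pair measurable_compose[OF measurable_fst y]
          measurable_compose[OF measurable_snd measurable_component_singleton]) simp
    from measurable_compose[OF this FF] show ?thesis by simp
  qed
  then have "(\<lambda>p. minibatch FF m (y (fst p)) (snd p)) \<in> borel_measurable (G \<Otimes>\<^sub>M sample_space \<Xi> m)"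
    unfolding minibatch_def by (intro borel_measurable_scaleR borel_measurable_const borel_measurable_sum) simp
  then show ?thesis by (simp add: split_beta')
qed

section \<open>Moments of the stochastic evaluations\<close>

lemma stochastic_oracle_mean_measurable:
  assumes "stochastic_oracle \<Xi> FF F \<sigma>"
  shows "F \<in> borel_measurable borel"
proof -
  interpret prob_space \<Xi> using assms by (simp add: stochastic_oracle_def)
  have "(\<lambda>x. \<integral>\<xi>. FF x \<xi> \<partial>\<Xi>) \<in> borel_measurable borel"
    using assms by (intro borel_measurable_lebesgue_integral) (simp add: stochastic_oracle_def)
  moreover have "(\<lambda>x. \<integral>\<xi>. FF x \<xi> \<partial>\<Xi>) = F"
    using assms by (auto simp: stochastic_oracle_def has_bochner_integral_iff)
  ultimately show ?thesis by simp
qed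

text \<open>
  A variance bound at a point makes \<open>FF\<close> square integrable there, since it differs from the centred
  evaluation by a constant. Hence the increment has a finite second moment for every pair of points.
\<close>

lemma stochastic_oracle_square_integrable:
  assumes "stochastic_oracle \<Xi> FF F \<sigma>"
  shows "square_integrable \<Xi> (\<lambda>\<xi>. FF x \<xi> - FF y \<xi>)" "(\<integral>\<xi>. FF x \<xi> - FF y \<xi> \<partial>\<Xi>) = F x - F y"
proof -
  interpret prob_space \<Xi> using assms by (simp add: stochastic_oracle_def)
  have I: "has_bochner_integral \<Xi> (FF x) (F x)" for x
    using assms by (simp add: stochastic_oracle_def)
  have sq: "square_integrable \<Xi> (FF x)" for x
  proof -
    have "FF x \<in> borel_measurable \<Xi>" using I[of x] by (simp add: has_bochner_integral_iff borel_measurable_integrable)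
    moreover have "(\<integral>\<^sup>+ \<xi>. ennreal ((norm (FF x \<xi> - F x))\<^sup>2) \<partial>\<Xi>) \<le> ennreal (\<sigma>\<^sup>2)"
      using assms by (simp add: stochastic_oracle_def)
    ultimately have "square_integrable \<Xi> (\<lambda>\<xi>. FF x \<xi> - F x)"
      by (intro square_integrableI_nn_integral) (auto simp: le_less_trans)
    from square_integrable_diff_const[OF finite_measure_axioms this, of "- F x"] show ?thesis by simp
  qed
  show "square_integrable \<Xi> (\<lambda>\<xi>. FF x \<xi> - FF y \<xi>)"
    using square_integrable_add[OF sq[of x] square_integrable_scaleR[OF sq[of y], of "-1"]] by simp
  show "(\<integral>\<xi>. FF x \<xi> - FF y \<xi> \<partial>\<Xi>) = F x - F y"
    using I by (intro has_bochner_integral_integral_eq has_bochner_integral_diff)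
qed

section \<open>One step of the hybrid recursion\<close>

text \<open>
  The step is stated for an arbitrary conditioning \<open>\<sigma>\<close>-algebra \<open>G\<close>, new and old points \<open>x\<close> and \<open>y\<close>, and
  previous estimate \<open>g\<close>; what matters is that \<open>x\<close>, \<open>y\<close> and \<open>g\<close> are known given \<open>G\<close> while the pair of
  samples is jointly independent of \<open>G\<close>. The two samples may depend on each other.
\<close>

lemma (in prob_space) hybrid_step_cond_exp_le:
  fixes x y g :: "'a \<Rightarrow> real ^ 'p" and Fb :: "'a \<Rightarrow> (nat \<Rightarrow> 'b) \<Rightarrow> real ^ 'p"
    and F :: "real ^ 'p \<Rightarrow> real ^ 'p"
  assumes stoch: "stochastic_oracle \<Xi> FF F \<sigma>"
    and sub: "subalgebra M G"
    and x: "x \<in> borel_measurable G" and y: "y \<in> borel_measurable G" and g: "g \<in> borel_measurable G"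
    and T: "iid_sample M \<Xi> m T" and m: "1 \<le> m" and Th: "iid_sample M \<Xi> mh Th" and mh: "1 \<le> mh"
    and fresh: "indep_set (sets G) (sets (vimage_algebra (space M) (\<lambda>\<omega>. (T \<omega>, Th \<omega>))
                  (sample_space \<Xi> m \<Otimes>\<^sub>M sample_space \<Xi> mh)))"
    and Fb: "(\<lambda>(\<omega>, s). Fb \<omega> s) \<in> borel_measurable (G \<Otimes>\<^sub>M sample_space \<Xi> mh)"
    and unbiased: "AE \<omega> in M. has_bochner_integral (sample_space \<Xi> mh) (Fb \<omega>) (F (x \<omega>))"
    and fin: "AE \<omega> in M. (\<integral>\<^sup>+ s. ennreal ((norm (Fb \<omega> s - F (x \<omega>)))\<^sup>2) \<partial>sample_space \<Xi> mh) < \<infinity>"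
    and r: "r = 2 \<or> r = 1 \<and> indep_var (sample_space \<Xi> m) T (sample_space \<Xi> mh) Th"
  shows "AE \<omega> in M. nn_cond_exp M G (\<lambda>\<omega>. ennreal ((norm (
        (1 - t) *\<^sub>R (g \<omega> + minibatch FF m (x \<omega>) (T \<omega>) - minibatch FF m (y \<omega>) (T \<omega>))
          + t *\<^sub>R Fb \<omega> (Th \<omega>) - F (x \<omega>)))\<^sup>2)) \<omega>
      \<le> ennreal ((1 - t)\<^sup>2) * ennreal ((norm (g \<omega> - F (y \<omega>)))\<^sup>2)
        + ennreal (r * (1 - t)\<^sup>2 / real m) * (\<integral>\<^sup>+ \<xi>. ennreal ((norm (FF (x \<omega>) \<xi> - FF (y \<omega>) \<xi>))\<^sup>2) \<partial>\<Xi>)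
        + ennreal (r * t\<^sup>2) * (\<integral>\<^sup>+ s. ennreal ((norm (Fb \<omega> s - F (x \<omega>)))\<^sup>2) \<partial>sample_space \<Xi> mh)"
proof -
  let ?P = "sample_space \<Xi> m" and ?Q = "sample_space \<Xi> mh"
  have \<Xi>: "prob_space \<Xi>" and FF: "(\<lambda>(x, \<xi>). FF x \<xi>) \<in> borel_measurable (borel \<Otimes>\<^sub>M \<Xi>)"
    using stoch by (simp_all add: stochastic_oracle_def)
  interpret Q: prob_space ?Q
    by (intro prob_space_PiM \<Xi>)
  have spG: "space G = space M" using sub by (simp add: subalgebra_def)
  have Tm: "T \<in> M \<rightarrow>\<^sub>M ?P" and Thm: "Th \<in> M \<rightarrow>\<^sub>M ?Q"
    by (rule iid_sample_measurable[OF T], rule iid_sample_measurable[OF Th])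
  define h where "h = (\<lambda>\<omega> z. ennreal ((norm (
        (1 - t) *\<^sub>R (g \<omega> + minibatch FF m (x \<omega>) (fst z) - minibatch FF m (y \<omega>) (fst z))
          + t *\<^sub>R Fb \<omega> (snd z) - F (x \<omega>)))\<^sup>2))"
  have h: "(\<lambda>(\<omega>, z). h \<omega> z) \<in> borel_measurable (G \<Otimes>\<^sub>M (?P \<Otimes>\<^sub>M ?Q))"
  proof -
    have p1: "(\<lambda>p. (fst p, fst (snd p))) \<in> G \<Otimes>\<^sub>M (?P \<Otimes>\<^sub>M ?Q) \<rightarrow>\<^sub>M G \<Otimes>\<^sub>M ?P"
      and p2: "(\<lambda>p. (fst p, snd (snd p))) \<in> G \<Otimes>\<^sub>M (?P \<Otimes>\<^sub>M ?Q) \<rightarrow>\<^sub>M G \<Otimes>\<^sub>M ?Q"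
      and p0: "fst \<in> G \<Otimes>\<^sub>M (?P \<Otimes>\<^sub>M ?Q) \<rightarrow>\<^sub>M G"
      by measurable
    have [measurable]: "(\<lambda>p. minibatch FF m (x (fst p)) (fst (snd p))) \<in> borel_measurable (G \<Otimes>\<^sub>M (?P \<Otimes>\<^sub>M ?Q))"
      using measurable_compose[OF p1 measurable_minibatch[OF FF x]] by simp
    have [measurable]: "(\<lambda>p. minibatch FF m (y (fst p)) (fst (snd p))) \<in> borel_measurable (G \<Otimes>\<^sub>M (?P \<Otimes>\<^sub>M ?Q))"
      using measurable_compose[OF p1 measurable_minibatch[OF FF y]] by simp
    have [measurable]: "(\<lambda>p. Fb (fst p) (snd (snd p))) \<in> borel_measurable (G \<Otimes>\<^sub>M (?P \<Otimes>\<^sub>M ?Q))"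
      using measurable_compose[OF p2 Fb] by simp
    have [measurable]: "(\<lambda>p. g (fst p)) \<in> borel_measurable (G \<Otimes>\<^sub>M (?P \<Otimes>\<^sub>M ?Q))"
      by (rule measurable_compose[OF p0 g])
    have [measurable]: "(\<lambda>p. F (x (fst p))) \<in> borel_measurable (G \<Otimes>\<^sub>M (?P \<Otimes>\<^sub>M ?Q))"
      by (rule measurable_compose[OF measurable_compose[OF p0 x] stochastic_oracle_mean_measurable[OF stoch]])
    show ?thesis
      unfolding h_def split_beta' by measurable
  qed
  have "AE \<omega> in M. nn_cond_exp M G (\<lambda>\<omega>. h \<omega> (T \<omega>, Th \<omega>)) \<omega> = (\<integral>\<^sup>+ \<omega>'. h \<omega> (T \<omega>', Th \<omega>') \<partial>M)"
    by (rule nn_cond_exp_freeze[OF sub measurable_Pair[OF Tm Thm] fresh h])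
  with unbiased fin AE_space show ?thesis
  proof eventually_elim
    fix \<omega> assume mean: "has_bochner_integral ?Q (Fb \<omega>) (F (x \<omega>))"
      and fin: "(\<integral>\<^sup>+ s. ennreal ((norm (Fb \<omega> s - F (x \<omega>)))\<^sup>2) \<partial>?Q) < \<infinity>"
      and \<omega>: "\<omega> \<in> space M"
      and freeze: "nn_cond_exp M G (\<lambda>\<omega>. h \<omega> (T \<omega>, Th \<omega>)) \<omega> = (\<integral>\<^sup>+ \<omega>'. h \<omega> (T \<omega>', Th \<omega>') \<partial>M)"
    \<comment> \<open>with \<open>\<omega>\<close> frozen, only the noises \<open>X\<close> and \<open>Y\<close> are random, through the fresh draws at \<open>\<omega>'\<close>\<close>
    define D where "D = (\<lambda>\<xi>. FF (x \<omega>) \<xi> - FF (y \<omega>) \<xi>)"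
    define d where "d = F (x \<omega>) - F (y \<omega>)"
    define u where "u = (\<lambda>s. (1 / real m) *\<^sub>R (\<Sum>i<m. D (s i)) - d)"
    define v where "v = (\<lambda>s. Fb \<omega> s - F (x \<omega>))"
    define X where "X = (\<lambda>\<omega>'. u (T \<omega>'))"
    define Y where "Y = (\<lambda>\<omega>'. v (Th \<omega>'))"
    have D: "square_integrable \<Xi> D" and d: "d = (\<integral>\<xi>. D \<xi> \<partial>\<Xi>)"
      unfolding D_def d_def by (simp_all only: stochastic_oracle_square_integrable[OF stoch])
    have X: "square_integrable M X" "expectation X = 0"
      "expectation (\<lambda>\<omega>. (norm (X \<omega>))\<^sup>2) \<le> (\<integral>\<xi>. (norm (D \<xi>))\<^sup>2 \<partial>\<Xi>) / real m"
      unfolding X_def u_def by (rule sample_average_error[OF \<Xi> T m D d])+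
    have vm: "v \<in> borel_measurable ?Q"
      using mean unfolding v_def
      by (intro borel_measurable_diff borel_measurable_const) (simp add: has_bochner_integral_iff borel_measurable_integrable)
    have v: "square_integrable ?Q v"
      using vm fin by (intro square_integrableI_nn_integral) (simp_all add: v_def)
    have v0: "(\<integral>s. v s \<partial>?Q) = 0"
      using mean by (simp add: v_def has_bochner_integral_iff Q.prob_space)
    note law = Thm iid_sample_distr[OF Th mh]
    have Y: "square_integrable M Y" "expectation Y = 0"
      unfolding Y_def using square_integrable_distr[OF law v] integral_distr_eq[OF law vm] v0
      by simp_all
    have Y2: "expectation (\<lambda>\<omega>. (norm (Y \<omega>))\<^sup>2) = (\<integral>s. (norm (v s))\<^sup>2 \<partial>?Q)"
      unfolding Y_def by (rule integral_distr_eq[OF law]) (use vm in measurable)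
    have um: "u \<in> borel_measurable ?P"
    proof -
      have "D \<in> borel_measurable \<Xi>" using D by (simp add: square_integrable_def)
      then have "(\<lambda>s. D (s i)) \<in> borel_measurable ?P" if "i < m" for i
        using that by (intro measurable_compose[OF measurable_component_singleton]) simp_all
      then show ?thesis
        unfolding u_def
        by (intro borel_measurable_diff borel_measurable_scaleR borel_measurable_const borel_measurable_sum) simp
    qed
    \<comment> \<open>independence passes from the samples to the noises, each a function of one sample\<close>
    have r': "r = 2 \<or> r = 1 \<and> indep_var borel X borel Y"
      using r indep_var_compose[of ?P T ?Q Th u borel v borel] um vm
      unfolding X_def Y_def by (auto simp: comp_def)
    define a where "a = (1 - t) *\<^sub>R (g \<omega> - F (y \<omega>))"
    have W: "square_integrable M (\<lambda>\<omega>'. a + ((1 - t) *\<^sub>R X \<omega>' + t *\<^sub>R Y \<omega>'))"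
      by (intro square_integrable_add square_integrable_scaleR square_integrable_const X Y)
    \<comment> \<open>the recursion, centred at \<open>F (x \<omega>)\<close>\<close>
    have "h \<omega> (T \<omega>', Th \<omega>') = ennreal ((norm (a + ((1 - t) *\<^sub>R X \<omega>' + t *\<^sub>R Y \<omega>')))\<^sup>2)" for \<omega>'
    proof -
      have mb: "(1 / real m) *\<^sub>R (\<Sum>i<m. D (T \<omega>' i)) =
          minibatch FF m (x \<omega>) (T \<omega>') - minibatch FF m (y \<omega>) (T \<omega>')"
        by (simp add: D_def minibatch_def sum_subtractf scaleR_diff_right)
      have "(1 - t) *\<^sub>R (g \<omega> + minibatch FF m (x \<omega>) (T \<omega>') - minibatch FF m (y \<omega>) (T \<omega>'))
          + t *\<^sub>R Fb \<omega> (Th \<omega>') - F (x \<omega>) = a + ((1 - t) *\<^sub>R X \<omega>' + t *\<^sub>R Y \<omega>')"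
        unfolding X_def Y_def u_def v_def a_def d_def mb by (simp add: algebra_simps)
      then show ?thesis by (simp add: h_def)
    qed
    then have "nn_cond_exp M G (\<lambda>\<omega>. h \<omega> (T \<omega>, Th \<omega>)) \<omega> =
        ennreal (expectation (\<lambda>\<omega>'. (norm (a + ((1 - t) *\<^sub>R X \<omega>' + t *\<^sub>R Y \<omega>')))\<^sup>2))"
      unfolding freeze using nn_integral_norm_sq[OF W] by simp
    also have "\<dots> \<le> ennreal ((1 - t)\<^sup>2 * (norm (g \<omega> - F (y \<omega>)))\<^sup>2
        + r * (1 - t)\<^sup>2 / real m * (\<integral>\<xi>. (norm (D \<xi>))\<^sup>2 \<partial>\<Xi>) + r * t\<^sup>2 * (\<integral>s. (norm (v s))\<^sup>2 \<partial>?Q))"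
    proof (rule ennreal_leI)
      have "0 \<le> r" using r by auto
      then have "r * (1 - t)\<^sup>2 * expectation (\<lambda>\<omega>. (norm (X \<omega>))\<^sup>2) \<le>
          r * (1 - t)\<^sup>2 * ((\<integral>\<xi>. (norm (D \<xi>))\<^sup>2 \<partial>\<Xi>) / real m)"
        by (intro mult_left_mono X(3)) simp
      then show "expectation (\<lambda>\<omega>'. (norm (a + ((1 - t) *\<^sub>R X \<omega>' + t *\<^sub>R Y \<omega>')))\<^sup>2) \<le>
          (1 - t)\<^sup>2 * (norm (g \<omega> - F (y \<omega>)))\<^sup>2
          + r * (1 - t)\<^sup>2 / real m * (\<integral>\<xi>. (norm (D \<xi>))\<^sup>2 \<partial>\<Xi>) + r * t\<^sup>2 * (\<integral>s. (norm (v s))\<^sup>2 \<partial>?Q)"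
        using second_moment_two_noises[OF X(1,2) Y r', of a "1 - t" t]
        by (simp add: Y2 a_def power_mult_distrib)
    qed
    also have "\<dots> = ennreal ((1 - t)\<^sup>2) * ennreal ((norm (g \<omega> - F (y \<omega>)))\<^sup>2)
        + ennreal (r * (1 - t)\<^sup>2 / real m) * ennreal (\<integral>\<xi>. (norm (D \<xi>))\<^sup>2 \<partial>\<Xi>)
        + ennreal (r * t\<^sup>2) * ennreal (\<integral>s. (norm (v s))\<^sup>2 \<partial>?Q)"
      using r by (auto simp: ennreal_plus[symmetric] ennreal_mult[symmetric] simp del: ennreal_plus)
    finally show "nn_cond_exp M G (\<lambda>\<omega>. ennreal ((norm (
        (1 - t) *\<^sub>R (g \<omega> + minibatch FF m (x \<omega>) (T \<omega>) - minibatch FF m (y \<omega>) (T \<omega>))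
          + t *\<^sub>R Fb \<omega> (Th \<omega>) - F (x \<omega>)))\<^sup>2)) \<omega>
      \<le> ennreal ((1 - t)\<^sup>2) * ennreal ((norm (g \<omega> - F (y \<omega>)))\<^sup>2)
        + ennreal (r * (1 - t)\<^sup>2 / real m) * (\<integral>\<^sup>+ \<xi>. ennreal ((norm (FF (x \<omega>) \<xi> - FF (y \<omega>) \<xi>))\<^sup>2) \<partial>\<Xi>)
        + ennreal (r * t\<^sup>2) * (\<integral>\<^sup>+ s. ennreal ((norm (Fb \<omega> s - F (x \<omega>)))\<^sup>2) \<partial>?Q)"
      using nn_integral_norm_sq[OF D] nn_integral_norm_sq[OF v]
      by (simp add: h_def D_def v_def)
  qed
qed

section \<open>Measurability with respect to the history\<close>

lemma sets_vimage_algebra_Pow: "sets (vimage_algebra \<Omega> f L) \<subseteq> Pow \<Omega>"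
  using sets.space_closed[of "vimage_algebra \<Omega> f L"] by simp

lemma sets_vimage_algebra_subset:
  assumes "f \<in> M \<rightarrow>\<^sub>M L"
  shows "sets (vimage_algebra (space M) f L) \<subseteq> sets M"
  unfolding sets_vimage_algebra
  by (rule sets.sigma_sets_subset) (use measurable_sets[OF assms] in auto)

lemma measurable_if_vimage_algebra_subset:
  assumes "f \<in> M \<rightarrow>\<^sub>M L" "space G = space M" "sets (vimage_algebra (space M) f L) \<subseteq> sets G"
  shows "f \<in> G \<rightarrow>\<^sub>M L"
proof (rule measurableI)
  show "f \<omega> \<in> space L" if "\<omega> \<in> space G" for \<omega>
    using measurable_space[OF assms(1)] that assms(2) by simp
  show "f -` A \<inter> space G \<in> sets G" if "A \<in> sets L" for A
    using in_vimage_algebra[OF that, of f "space M"] assms(2,3) by auto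
qed

text \<open>
  The family that generates \<open>history\<close>, named so that monotonicity in \<open>k\<close> and measurability of single
  variables can be checked on generators.
\<close>

definition history_generators ::
  "'w measure \<Rightarrow> 'b measure \<Rightarrow> 'u measure \<Rightarrow> (nat \<Rightarrow> 'w \<Rightarrow> 'u) \<Rightarrow> (nat \<Rightarrow> 'w \<Rightarrow> real ^ 'p) \<Rightarrow>
   ('w \<Rightarrow> real ^ 'p) \<Rightarrow> (nat \<Rightarrow> nat) \<Rightarrow> (nat \<Rightarrow> nat) \<Rightarrow>
   (nat \<Rightarrow> 'w \<Rightarrow> nat \<Rightarrow> 'b) \<Rightarrow> (nat \<Rightarrow> 'w \<Rightarrow> nat \<Rightarrow> 'b) \<Rightarrow> nat \<Rightarrow> 'w set set" where
  "history_generators M \<Xi> N U x F0 b bh S Sh k =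
     (\<Union>j\<le>k. sets (vimage_algebra (space M) (x j) borel)) \<union>
     (\<Union>j\<le>k. sets (vimage_algebra (space M) (U j) N)) \<union>
     (if 1 \<le> k then sets (vimage_algebra (space M) F0 borel) else {}) \<union>
     (\<Union>j\<in>{1..<k}. sets (vimage_algebra (space M) (S j) (sample_space \<Xi> (b j)))) \<union>
     (\<Union>j\<in>{1..<k}. sets (vimage_algebra (space M) (Sh j) (sample_space \<Xi> (bh j))))"

lemma history_eq_sigma:
  "history M \<Xi> N U x F0 b bh S Sh k = sigma (space M) (history_generators M \<Xi> N U x F0 b bh S Sh k)"
  by (simp only: history_def history_generators_def)

lemma space_history: "space (history M \<Xi> N U x F0 b bh S Sh k) = space M"
  by (simp add: history_eq_sigma space_measure_of_conv)

lemma sets_history: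
  "sets (history M \<Xi> N U x F0 b bh S Sh k) =
    sigma_sets (space M) (history_generators M \<Xi> N U x F0 b bh S Sh k)"
proof -
  have "history_generators M \<Xi> N U x F0 b bh S Sh k \<subseteq> Pow (space M)"
    unfolding history_generators_def by (intro Un_least UN_least) (simp_all add: sets_vimage_algebra_Pow)
  then show ?thesis
    by (simp add: history_eq_sigma)
qed

lemma history_mono:
  assumes "j \<le> k"
  shows "sets (history M \<Xi> N U x F0 b bh S Sh j) \<subseteq> sets (history M \<Xi> N U x F0 b bh S Sh k)"
proof -
  have "history_generators M \<Xi> N U x F0 b bh S Sh j \<subseteq> history_generators M \<Xi> N U x F0 b bh S Sh k"
    unfolding history_generators_def
    by (intro Un_mono UN_mono) (use assms in auto)
  then show ?thesis
    unfolding sets_history by (rule sigma_sets_mono')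
qed

lemma subalgebra_history:
  assumes "\<And>j. x j \<in> borel_measurable M" "\<And>j. U j \<in> M \<rightarrow>\<^sub>M N" "F0 \<in> borel_measurable M"
    "\<And>j. 1 \<le> j \<Longrightarrow> S j \<in> M \<rightarrow>\<^sub>M sample_space \<Xi> (b j)"
    "\<And>j. 1 \<le> j \<Longrightarrow> Sh j \<in> M \<rightarrow>\<^sub>M sample_space \<Xi> (bh j)"
  shows "subalgebra M (history M \<Xi> N U x F0 b bh S Sh k)"
proof -
  have "history_generators M \<Xi> N U x F0 b bh S Sh k \<subseteq> sets M"
    unfolding history_generators_def
    by (intro Un_least UN_least) (simp_all add: sets_vimage_algebra_subset assms)
  then show ?thesis
    unfolding subalgebra_def sets_history space_history by (simp add: sets.sigma_sets_subset)
qed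

lemma measurable_historyI:
  assumes "f \<in> M \<rightarrow>\<^sub>M L"
    and "sets (vimage_algebra (space M) f L) \<subseteq> history_generators M \<Xi> N U x F0 b bh S Sh k"
  shows "f \<in> history M \<Xi> N U x F0 b bh S Sh k \<rightarrow>\<^sub>M L"
  by (rule measurable_if_vimage_algebra_subset[OF assms(1) space_history])
    (use assms(2) in \<open>auto simp: sets_history\<close>)

lemma measurable_history_iterate:
  "x j \<in> borel_measurable M \<Longrightarrow> j \<le> k \<Longrightarrow> x j \<in> borel_measurable (history M \<Xi> N U x F0 b bh S Sh k)"
  by (erule measurable_historyI) (auto simp: history_generators_def)

lemma measurable_history_initial:
  "F0 \<in> borel_measurable M \<Longrightarrow> 1 \<le> k \<Longrightarrow> F0 \<in> borel_measurable (history M \<Xi> N U x F0 b bh S Sh k)"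
  by (erule measurable_historyI) (auto simp: history_generators_def)

lemma measurable_history_samples:
  assumes "1 \<le> j" "j < k"
  shows "S j \<in> M \<rightarrow>\<^sub>M sample_space \<Xi> (b j) \<Longrightarrow>
      S j \<in> history M \<Xi> N U x F0 b bh S Sh k \<rightarrow>\<^sub>M sample_space \<Xi> (b j)"
    and "Sh j \<in> M \<rightarrow>\<^sub>M sample_space \<Xi> (bh j) \<Longrightarrow>
      Sh j \<in> history M \<Xi> N U x F0 b bh S Sh k \<rightarrow>\<^sub>M sample_space \<Xi> (bh j)"
proof -
  have j: "j \<in> {1..<k}" using assms by simp
  show "S j \<in> M \<rightarrow>\<^sub>M sample_space \<Xi> (b j) \<Longrightarrow>
      S j \<in> history M \<Xi> N U x F0 b bh S Sh k \<rightarrow>\<^sub>M sample_space \<Xi> (b j)"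
    by (erule measurable_historyI) (use j in \<open>unfold history_generators_def, blast\<close>)
  show "Sh j \<in> M \<rightarrow>\<^sub>M sample_space \<Xi> (bh j) \<Longrightarrow>
      Sh j \<in> history M \<Xi> N U x F0 b bh S Sh k \<rightarrow>\<^sub>M sample_space \<Xi> (bh j)"
    by (erule measurable_historyI) (use j in \<open>unfold history_generators_def, blast\<close>)
qed

text \<open>
  The estimate of iteration \<open>k\<close> uses the draws of iteration \<open>k\<close>, which enter the history only at
  \<open>k + 1\<close>. Hence the previous estimate is known when iteration \<open>k + 1\<close> conditions on its history.
\<close>

lemma hsgd_adapted:
  fixes x :: "nat \<Rightarrow> 'w \<Rightarrow> real ^ 'p"
  assumes FF: "(\<lambda>(x, \<xi>). FF x \<xi>) \<in> borel_measurable (borel \<Otimes>\<^sub>M \<Xi>)"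
    and x: "\<And>j. x j \<in> borel_measurable M" and F0: "F0 \<in> borel_measurable M"
    and S: "\<And>j. 1 \<le> j \<Longrightarrow> S j \<in> M \<rightarrow>\<^sub>M sample_space \<Xi> (b j)"
    and Sh: "\<And>j. 1 \<le> j \<Longrightarrow> Sh j \<in> M \<rightarrow>\<^sub>M sample_space \<Xi> (bh j)"
    and Fbar: "\<And>j. 1 \<le> j \<Longrightarrow> (\<lambda>(\<omega>, s). Fbar j \<omega> s) \<in>
      borel_measurable (history M \<Xi> N U x F0 b bh S Sh j \<Otimes>\<^sub>M sample_space \<Xi> (bh j))"
  shows "hsgd FF Fbar \<tau> b x F0 S Sh k \<in> borel_measurable (history M \<Xi> N U x F0 b bh S Sh (Suc k))"
proof (induction k)
  case 0
  have "hsgd FF Fbar \<tau> b x F0 S Sh 0 = F0" by auto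
  then show ?case by (simp add: measurable_history_initial[OF F0])
next
  case (Suc k)
  let ?H = "history M \<Xi> N U x F0 b bh S Sh"
  have sub: "subalgebra (?H (Suc (Suc k))) (?H (Suc k))"
    unfolding subalgebra_def by (simp add: space_history history_mono)
  have prev: "hsgd FF Fbar \<tau> b x F0 S Sh k \<in> borel_measurable (?H (Suc (Suc k)))"
    by (rule measurable_from_subalg[OF sub Suc.IH])
  have id: "(\<lambda>\<omega>. \<omega>) \<in> ?H (Suc (Suc k)) \<rightarrow>\<^sub>M ?H (Suc k)"
    using measurable_from_subalg[OF sub measurable_ident] by (simp add: id_def)
  have S': "S (Suc k) \<in> ?H (Suc (Suc k)) \<rightarrow>\<^sub>M sample_space \<Xi> (b (Suc k))"
    by (rule measurable_history_samples(1)) (simp_all add: S)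
  have Sh': "Sh (Suc k) \<in> ?H (Suc (Suc k)) \<rightarrow>\<^sub>M sample_space \<Xi> (bh (Suc k))"
    by (rule measurable_history_samples(2)) (simp_all add: Sh)
  have mb: "(\<lambda>\<omega>. minibatch FF (b (Suc k)) (x j \<omega>) (S (Suc k) \<omega>)) \<in> borel_measurable (?H (Suc (Suc k)))"
    if "j \<le> Suc k" for j
  proof -
    have "x j \<in> borel_measurable (?H (Suc (Suc k)))"
      by (rule measurable_history_iterate) (use x that in simp_all)
    then show ?thesis
      using measurable_compose[OF measurable_Pair[OF measurable_ident_sets[OF refl] S']
          measurable_minibatch[OF FF]] by simp
  qed
  have "(\<lambda>\<omega>. Fbar (Suc k) \<omega> (Sh (Suc k) \<omega>)) \<in> borel_measurable (?H (Suc (Suc k)))"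
    using measurable_compose[OF measurable_Pair[OF id Sh'] Fbar] by simp
  then have "(\<lambda>\<omega>. hsgd FF Fbar \<tau> b x F0 S Sh (Suc k) \<omega>) \<in> borel_measurable (?H (Suc (Suc k)))"
    unfolding hsgd.simps
    by (intro borel_measurable_add borel_measurable_diff borel_measurable_scaleR borel_measurable_const
        prev mb) simp_all
  then show ?case by simp
qed

section \<open>The hybrid SGD estimator\<close>

theorem lemma8:
  fixes M :: "'w measure" and \<Xi> :: "'b measure" and N :: "'u measure"
    and F :: "real ^ 'p \<Rightarrow> real ^ 'p" and FF :: "real ^ 'p \<Rightarrow> 'b \<Rightarrow> real ^ 'p"
    and x :: "nat \<Rightarrow> 'w \<Rightarrow> real ^ 'p" and U :: "nat \<Rightarrow> 'w \<Rightarrow> 'u"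
    and F0 :: "'w \<Rightarrow> real ^ 'p"
    and S Sh :: "nat \<Rightarrow> 'w \<Rightarrow> nat \<Rightarrow> 'b"
    and Fbar :: "nat \<Rightarrow> 'w \<Rightarrow> (nat \<Rightarrow> 'b) \<Rightarrow> real ^ 'p"
    and \<tau> :: "nat \<Rightarrow> real" and b bh :: "nat \<Rightarrow> nat" and n\<^sub>0 :: nat and \<sigma> :: real
    and H :: "nat \<Rightarrow> 'w measure" and Ft :: "nat \<Rightarrow> 'w \<Rightarrow> real ^ 'p"
    and \<Delta> :: "nat \<Rightarrow> 'w \<Rightarrow> real" and \<delta>2 :: "nat \<Rightarrow> 'w \<Rightarrow> ennreal"
    and indep :: "nat \<Rightarrow> bool"
  defines "H \<equiv> history M \<Xi> N U x F0 b bh S Sh"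
    and "Ft \<equiv> hsgd FF Fbar \<tau> b x F0 S Sh"
    and "\<Delta> \<equiv> \<lambda>k \<omega>. (norm (Ft k \<omega> - F (x k \<omega>)))\<^sup>2"
    and "\<delta>2 \<equiv> \<lambda>k \<omega>. \<integral>\<^sup>+ s. ennreal ((norm (Fbar k \<omega> s - F (x k \<omega>)))\<^sup>2) \<partial>sample_space \<Xi> (bh k)"
    and "indep \<equiv> \<lambda>k. prob_space.indep_var M (sample_space \<Xi> (b k)) (S k) (sample_space \<Xi> (bh k)) (Sh k)"
  assumes "prob_space M"
    and "stochastic_oracle \<Xi> FF F \<sigma>"
    and "\<forall>k. x k \<in> borel_measurable M"
    and "\<forall>k. U k \<in> M \<rightarrow>\<^sub>M N"
    and "F0 \<in> borel_measurable M" and "1 \<le> n\<^sub>0"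
    and "AE \<omega> in M. nn_cond_exp M (H 0) (\<lambda>\<omega>. ennreal ((norm (F0 \<omega> - F (x 0 \<omega>)))\<^sup>2)) \<omega>
           \<le> ennreal (\<sigma>\<^sup>2 / real n\<^sub>0)"
    and "\<forall>k\<ge>1. 0 \<le> \<tau> k \<and> \<tau> k \<le> 1 \<and> 1 \<le> b k \<and> 1 \<le> bh k"
    and "\<forall>k\<ge>1. iid_sample M \<Xi> (b k) (S k) \<and> iid_sample M \<Xi> (bh k) (Sh k)"
    and "\<forall>k\<ge>1. prob_space.indep_set M (sets (H k))
           (sets (vimage_algebra (space M) (\<lambda>\<omega>. (S k \<omega>, Sh k \<omega>))
              (sample_space \<Xi> (b k) \<Otimes>\<^sub>M sample_space \<Xi> (bh k))))"
    and "\<forall>k\<ge>1. (\<lambda>(\<omega>, s). Fbar k \<omega> s) \<in> borel_measurable (H k \<Otimes>\<^sub>M sample_space \<Xi> (bh k))"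
    and "\<forall>k\<ge>1. AE \<omega> in M. has_bochner_integral (sample_space \<Xi> (bh k)) (Fbar k \<omega>) (F (x k \<omega>))"
    and "\<forall>k\<ge>1. AE \<omega> in M. \<delta>2 k \<omega> \<le> ennreal (\<sigma>\<^sup>2 / real (bh k))"
  shows "(\<forall>k\<ge>1. indep k \<longrightarrow>
            (AE \<omega> in M. nn_cond_exp M (H k) (\<lambda>\<omega>. ennreal (\<Delta> k \<omega>)) \<omega>
               \<le> ennreal ((1 - \<tau> k)\<^sup>2) * ennreal (\<Delta> (k - 1) \<omega>)
                 + ennreal ((1 - \<tau> k)\<^sup>2 / real (b k)) * Ebar \<Xi> FF x k \<omega>
                 + ennreal ((\<tau> k)\<^sup>2) * \<delta>2 k \<omega>))
       \<and> (\<forall>k\<ge>1. \<not> indep k \<or> (\<forall>\<omega>\<in>space M. S k \<omega> = Sh k \<omega>) \<longrightarrow>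
            (AE \<omega> in M. nn_cond_exp M (H k) (\<lambda>\<omega>. ennreal (\<Delta> k \<omega>)) \<omega>
               \<le> ennreal ((1 - \<tau> k)\<^sup>2) * ennreal (\<Delta> (k - 1) \<omega>)
                 + ennreal (2 * (1 - \<tau> k)\<^sup>2 / real (b k)) * Ebar \<Xi> FF x k \<omega>
                 + ennreal (2 * (\<tau> k)\<^sup>2) * \<delta>2 k \<omega>))
       \<and> ((\<forall>k\<ge>1. 0 < \<tau> k) \<longrightarrow>
            VR_property M H F x (Ebar \<Xi> FF x) Ft \<Delta>
              (\<lambda>k. 1 - (1 - \<tau> k)\<^sup>2)
              (\<lambda>k. if indep k then (1 - \<tau> k)\<^sup>2 / real (b k) else 2 * (1 - \<tau> k)\<^sup>2 / real (b k))
              (\<lambda>k. if indep k then sqrt ((\<tau> k)\<^sup>2 * \<sigma>\<^sup>2 / real (bh k))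
                   else sqrt (2 * (\<tau> k)\<^sup>2 * \<sigma>\<^sup>2 / real (bh k))))"
proof -
  note stoch = assms(7) and x_meas = assms(8) and U_meas = assms(9) and F0_meas = assms(10)
    and weights = assms(13) and iid = assms(14) and fresh = assms(15)
    and Fbar_meas = assms(16) and unbiased = assms(17) and Fbar_var = assms(18)
  interpret prob_space M by (rule assms(6))
  have S: "S k \<in> M \<rightarrow>\<^sub>M sample_space \<Xi> (b k)" and Sh: "Sh k \<in> M \<rightarrow>\<^sub>M sample_space \<Xi> (bh k)"
    if "1 \<le> k" for k
    using iid that by (simp_all add: iid_sample_def)
  have FF: "(\<lambda>(x, \<xi>). FF x \<xi>) \<in> borel_measurable (borel \<Otimes>\<^sub>M \<Xi>)"
    using stoch by (simp add: stochastic_oracle_def)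
  have F: "F \<in> borel_measurable borel"
    by (rule stochastic_oracle_mean_measurable[OF stoch])
  have sub: "subalgebra M (H k)" for k
    unfolding H_def using x_meas U_meas F0_meas S Sh by (intro subalgebra_history) auto
  have adapted: "Ft k \<in> borel_measurable (H (Suc k))" for k
    unfolding Ft_def H_def
    using x_meas F0_meas Fbar_meas FF S Sh unfolding H_def by (intro hsgd_adapted) auto
  have \<Delta>: "\<Delta> k \<in> borel_measurable M" for k
    unfolding \<Delta>_def
    using measurable_from_subalg[OF sub adapted, of k] measurable_compose[OF x_meas[rule_format] F, of k]
    by measurable
  \<comment> \<open>\<open>r = 1\<close> is (i) and \<open>r = 2\<close> is (ii)\<close>
  have step: "AE \<omega> in M. nn_cond_exp M (H k) (\<lambda>\<omega>. ennreal (\<Delta> k \<omega>)) \<omega>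
      \<le> ennreal ((1 - \<tau> k)\<^sup>2) * ennreal (\<Delta> (k - 1) \<omega>)
        + ennreal (r * (1 - \<tau> k)\<^sup>2 / real (b k)) * Ebar \<Xi> FF x k \<omega>
        + ennreal (r * (\<tau> k)\<^sup>2) * \<delta>2 k \<omega>"
    if k: "1 \<le> k" and r: "r = 2 \<or> r = 1 \<and> indep k" for k r
  proof -
    obtain j where j: "k = Suc j" using k by (cases k) auto
    have "AE \<omega> in M. \<delta>2 k \<omega> < \<infinity>"
      using Fbar_var[rule_format, OF k] by eventually_elim (auto simp: le_less_trans)
    moreover have "Ft j \<in> borel_measurable (H k)" using adapted[of j] by (simp add: j)
    moreover have "x k \<in> borel_measurable (H k)" "x j \<in> borel_measurable (H k)"
      unfolding H_def using x_meas by (auto intro!: measurable_history_iterate simp: j)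
    ultimately have "AE \<omega> in M. nn_cond_exp M (H k) (\<lambda>\<omega>. ennreal ((norm (
        (1 - \<tau> k) *\<^sub>R (Ft j \<omega> + minibatch FF (b k) (x k \<omega>) (S k \<omega>) - minibatch FF (b k) (x j \<omega>) (S k \<omega>))
          + \<tau> k *\<^sub>R Fbar k \<omega> (Sh k \<omega>) - F (x k \<omega>)))\<^sup>2)) \<omega>
      \<le> ennreal ((1 - \<tau> k)\<^sup>2) * ennreal ((norm (Ft j \<omega> - F (x j \<omega>)))\<^sup>2)
        + ennreal (r * (1 - \<tau> k)\<^sup>2 / real (b k)) * (\<integral>\<^sup>+ \<xi>. ennreal ((norm (FF (x k \<omega>) \<xi> - FF (x j \<omega>) \<xi>))\<^sup>2) \<partial>\<Xi>)
        + ennreal (r * (\<tau> k)\<^sup>2) * (\<integral>\<^sup>+ s. ennreal ((norm (Fbar k \<omega> s - F (x k \<omega>)))\<^sup>2) \<partial>sample_space \<Xi> (bh k))"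
      using weights iid fresh Fbar_meas unbiased k r unfolding \<delta>2_def indep_def
      by (intro hybrid_step_cond_exp_le[OF stoch sub]) auto
    then show ?thesis
      by (simp add: j \<Delta>_def Ft_def Ebar_def \<delta>2_def)
  qed
  have VR: "VR_property M H F x (Ebar \<Xi> FF x) Ft \<Delta>
      (\<lambda>k. 1 - (1 - \<tau> k)\<^sup>2)
      (\<lambda>k. if indep k then (1 - \<tau> k)\<^sup>2 / real (b k) else 2 * (1 - \<tau> k)\<^sup>2 / real (b k))
      (\<lambda>k. if indep k then sqrt ((\<tau> k)\<^sup>2 * \<sigma>\<^sup>2 / real (bh k))
           else sqrt (2 * (\<tau> k)\<^sup>2 * \<sigma>\<^sup>2 / real (bh k)))"
    (is "VR_property _ _ _ _ _ _ _ ?\<kappa> ?\<Theta> ?\<sigma>") if \<tau>: "\<forall>k\<ge>1. 0 < \<tau> k"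
    unfolding VR_property_def
  proof (intro conjI allI impI ballI)
    fix k :: nat assume k: "1 \<le> k"
    have t: "0 < \<tau> k" "\<tau> k \<le> 1" using \<tau> weights k by auto
    then have "(1 - \<tau> k)\<^sup>2 < 1" by (simp add: power_less_one_iff abs_square_less_1)
    then show "0 < ?\<kappa> k" by simp
    show "?\<kappa> k \<le> 1" "0 \<le> ?\<Theta> k" "0 \<le> ?\<sigma> k" by simp_all
    \<comment> \<open>\<open>\<Theta>\<close> and \<open>\<sigma>\<close> are those of (i) or (ii), whichever case applies at this \<open>k\<close>\<close>
    define r :: real where "r = (if indep k then 1 else 2)"
    have r: "r = 2 \<or> r = 1 \<and> indep k" and r0: "0 \<le> r" by (simp_all add: r_def)
    have \<Theta>: "?\<Theta> k = r * (1 - \<tau> k)\<^sup>2 / real (b k)" by (simp add: r_def)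
    have \<sigma>2: "(?\<sigma> k)\<^sup>2 = r * (\<tau> k)\<^sup>2 * (\<sigma>\<^sup>2 / real (bh k))" by (simp add: r_def)
    show "AE \<omega> in M. nn_cond_exp M (H k) (\<lambda>\<omega>. ennreal (\<Delta> k \<omega>)) \<omega>
        \<le> ennreal (1 - ?\<kappa> k) * ennreal (\<Delta> (k - 1) \<omega>) + ennreal (?\<Theta> k) * Ebar \<Xi> FF x k \<omega>
          + ennreal ((?\<sigma> k)\<^sup>2)"
      using step[OF k r] Fbar_var[rule_format, OF k]
    proof eventually_elim
      case (elim \<omega>)
      have "ennreal (r * (\<tau> k)\<^sup>2) * \<delta>2 k \<omega> \<le> ennreal (r * (\<tau> k)\<^sup>2) * ennreal (\<sigma>\<^sup>2 / real (bh k))"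
        by (intro mult_left_mono elim) simp
      also have "\<dots> = ennreal ((?\<sigma> k)\<^sup>2)"
        unfolding \<sigma>2 using r0 by (intro ennreal_mult[symmetric]) simp_all
      finally have noise: "ennreal (r * (\<tau> k)\<^sup>2) * \<delta>2 k \<omega> \<le> ennreal ((?\<sigma> k)\<^sup>2)" .
      have \<kappa>: "1 - ?\<kappa> k = (1 - \<tau> k)\<^sup>2" by simp
      show ?case
        unfolding \<kappa> \<Theta> by (rule order_trans[OF elim(1)]) (intro add_left_mono noise)
    qed
  qed (use \<Delta> in \<open>simp_all add: \<Delta>_def\<close>)
  show ?thesis
    using step[of _ 1] step[of _ 2] VR by simp
qed

end
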